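(* Let $G$ be a totally disconnected locally compact group and $\phi:G\to G$ a topological automorphism. If $G\cong\varinjlim_{i\in I}H_i$, where $\{H_i\}_{i\in I}$ is a directed system of $\phi$-stable open subgroups of $G$, then there exists $j\in I$ such that $$s(\phi)=s(\phi\restriction_{H_j})=\max_{i\in I}s(\phi\restriction_{H_i}).$$
   Context: A topological automorphism is a group automorphism that is also a homeomorphism. A subgroup $H$ of $G$ is $\phi$-stable if $\phi(H)=H$. That $G$ is the direct limit of the directed system $\{H_i\}_{i\in I}$ of subgroups of $G$ means that the family is directed under inclusion, with the inclusions as transition maps, and $G=\bigcup_{i\in I}H_i$. Scale: for a totally disconnected locally compact group $G$ and a topological automorphism $\phi$ of $G$, let $\mathcal B(G)$ be the family of all compact open subgroups of $G$; the scale of $\phi$ is $s(\phi)=\min\{[\phi(U):U\cap\phi(U)]:U\in\mathcal B(G)\}$. Each $s(\phi\restriction_{H_i})$ is the scale of the restriction $\phi\restriction_{H_i}:H_i\to H_i$, computed in the totally disconnected locally compact group $H_i$. *)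

theory Defs
  imports "HOL-Analysis.Analysis" "HOL-Algebra.Coset"
begin

locale topological_group = group G for G (structure) +
  fixes T :: "'a topology"
  assumes topspace_eq_carrier: "topspace T = carrier G"
    and continuous_mult: "continuous_map (prod_topology T T) T (\<lambda>(x, y). x \<otimes> y)"
    and continuous_inv: "continuous_map T T (\<lambda>x. inv x)"

definition totally_disconnected_space :: "'a topology \<Rightarrow> bool" where
  "totally_disconnected_space T \<longleftrightarrow>
     (\<forall>x\<in>topspace T. connected_component_of_set T x = {x})"

text \<open>Such a group is automatically Hausdorff: connected components are closed, so points
  are closed, and a topological group with closed points is Hausdorff.\<close>

locale tdlc_group = topological_group +
  assumes totally_disconnected: "totally_disconnected_space T"
    and locally_compact: "locally_compact_space T"

definition topological_automorphism ::
    "('a, 'b) monoid_scheme \<Rightarrow> 'a topology \<Rightarrow> ('a \<Rightarrow> 'a) \<Rightarrow> bool" where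
  "topological_automorphism G T \<phi> \<longleftrightarrow> \<phi> \<in> iso G G \<and> homeomorphic_map T T \<phi>"

definition compact_open_subgroups ::
    "('a, 'b) monoid_scheme \<Rightarrow> 'a topology \<Rightarrow> 'a set set" where
  "compact_open_subgroups G T = {U. subgroup U G \<and> compactin T U \<and> openin T U}"

text \<open>The index $[K : L]$ of a subgroup $L$ of $K$, where $K$ is a subgroup of $G$.
  It has the junk value 0 if the index is infinite.\<close>

definition subgroup_index ::
    "('a, 'b) monoid_scheme \<Rightarrow> 'a set \<Rightarrow> 'a set \<Rightarrow> nat" where
  "subgroup_index G K L = card (rcosets\<^bsub>G\<lparr>carrier := K\<rparr>\<^esub> L)"

text \<open>For a topological automorphism \<open>\<phi>\<close> and a compact open subgroup \<open>U\<close>, the intersection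
  \<open>U \<inter> \<phi> ` U\<close> is open in the compact group \<open>\<phi> ` U\<close>. Hence all the indices below are finite and
  positive, and the junk value of \<^const>\<open>subgroup_index\<close> never occurs.
  In a totally disconnected locally compact group, compact open subgroups exist by van Dantzig's
  theorem, so the minimum is attained.\<close>

definition scale ::
    "('a, 'b) monoid_scheme \<Rightarrow> 'a topology \<Rightarrow> ('a \<Rightarrow> 'a) \<Rightarrow> nat" where
  "scale G T \<phi> =
     (LEAST n. \<exists>U\<in>compact_open_subgroups G T. n = subgroup_index G (\<phi> ` U) (U \<inter> \<phi> ` U))"

definition directed_family :: "'i set \<Rightarrow> ('i \<Rightarrow> 'a set) \<Rightarrow> bool" where
  "directed_family I H \<longleftrightarrow>
     I \<noteq> {} \<and> (\<forall>i\<in>I. \<forall>j\<in>I. \<exists>k\<in>I. H i \<subseteq> H k \<and> H j \<subseteq> H k)"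

text \<open>The scale of the restriction of \<open>\<phi>\<close> to a \<open>\<phi>\<close>-stable subgroup \<open>H\<close>, computed in \<open>H\<close> with
  the subspace topology.\<close>

definition restricted_scale ::
    "('a, 'b) monoid_scheme \<Rightarrow> 'a topology \<Rightarrow> ('a \<Rightarrow> 'a) \<Rightarrow> 'a set \<Rightarrow> nat" where
  "restricted_scale G T \<phi> H = scale (G\<lparr>carrier := H\<rparr>) (subtopology T H) (restrict \<phi> H)"

end

theory Submission
  imports Defs
begin

text \<open>
  The scale of \<open>\<phi>\<close> already agrees with the scale of its restriction to \<^emph>\<open>every\<close> open
  \<open>\<phi>\<close>-stable subgroup \<open>H\<close> (\<open>restricted_scale_open_stable\<close>). So the family
  of the \<open>s(\<phi>\<restriction>H\<^sub>i)\<close> is constant, and any index witnesses the claim.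

  The two inequalities have different reasons. As \<open>H\<close> is open, a compact open subgroup of \<open>H\<close>
  is one of \<open>G\<close>, with the same displacement index; hence \<open>s(\<phi>) \<le> s(\<phi>\<restriction>H)\<close>. Conversely, for a
  compact open subgroup \<open>U\<close> of \<open>G\<close>, the intersection \<open>U \<inter> H\<close> is a compact open subgroup of \<open>H\<close>,
  because open subgroups are closed. Stability gives \<open>\<phi>(U \<inter> H) = \<phi>(U) \<inter> H\<close>, so that its
  index is \<open>[\<phi>(U) \<inter> H : U \<inter> \<phi>(U) \<inter> H]\<close>. Cutting down to a subgroup does not increase a finite
  index (\<open>subgroup_index_Int_le\<close>), hence \<open>s(\<phi>\<restriction>H) \<le> s(\<phi>)\<close>. The index in \<open>G\<close> is finite by
  compactness of \<open>\<phi>(U)\<close>.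
\<close>

lemma (in group) rcosets_carrier_update:
  "rcosets\<^bsub>G\<lparr>carrier := K\<rparr>\<^esub> L = (\<lambda>a. L #> a) ` K"
  by (auto simp: RCOSETS_def r_coset_def)

text \<open>Every coset of \<open>L \<inter> H\<close> by an element of \<open>K \<inter> H\<close> is the trace on \<open>H\<close> of a coset of \<open>L\<close>.
  Finiteness excludes that the larger index has the junk value 0.\<close>

lemma (in group) subgroup_index_Int_le:
  assumes H: "subgroup H G" and L: "subgroup L G"
    and fin: "finite (rcosets\<^bsub>G\<lparr>carrier := K\<rparr>\<^esub> L)"
  shows "subgroup_index G (K \<inter> H) (L \<inter> H) \<le> subgroup_index G K L"
proof -
  have trace: "(L \<inter> H) #> a = (L #> a) \<inter> H" if a: "a \<in> H" for a
  proof
    show "(L \<inter> H) #> a \<subseteq> (L #> a) \<inter> H"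
      using a H by (auto simp: r_coset_def subgroup.m_closed)
    show "(L #> a) \<inter> H \<subseteq> (L \<inter> H) #> a"
    proof
      fix x assume x: "x \<in> (L #> a) \<inter> H"
      then obtain l where l: "l \<in> L" "x = l \<otimes> a" by (auto simp: r_coset_def)
      have "l = x \<otimes> inv a"
        using l a subgroup.mem_carrier[OF H] subgroup.mem_carrier[OF L] by (simp add: m_assoc)
      then have "l \<in> H"
        using x a H by (auto simp: subgroup.m_closed subgroup.m_inv_closed)
      then show "x \<in> (L \<inter> H) #> a" using l by (auto simp: r_coset_def)
    qed
  qed
  have "rcosets\<^bsub>G\<lparr>carrier := K \<inter> H\<rparr>\<^esub> (L \<inter> H)
      \<subseteq> (\<lambda>C. C \<inter> H) ` (rcosets\<^bsub>G\<lparr>carrier := K\<rparr>\<^esub> L)"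
    unfolding rcosets_carrier_update using trace by auto
  then have "card (rcosets\<^bsub>G\<lparr>carrier := K \<inter> H\<rparr>\<^esub> (L \<inter> H))
      \<le> card ((\<lambda>C. C \<inter> H) ` (rcosets\<^bsub>G\<lparr>carrier := K\<rparr>\<^esub> L))"
    using fin by (intro card_mono) auto
  also have "\<dots> \<le> card (rcosets\<^bsub>G\<lparr>carrier := K\<rparr>\<^esub> L)"
    using fin by (rule card_image_le)
  finally show ?thesis by (simp add: subgroup_index_def)
qed

context topological_group
begin

lemma openin_r_coset:
  assumes L: "openin T L" and a: "a \<in> carrier G"
  shows "openin T (L #> a)"
proof -
  have sub: "L \<subseteq> carrier G"
    using openin_subset[OF L] topspace_eq_carrier by simp
  have "continuous_map T (prod_topology T T) (\<lambda>x. (x, inv a))"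
    using a by (intro continuous_map_pairedI) (auto simp: topspace_eq_carrier)
  then have "continuous_map T T ((\<lambda>(x, y). x \<otimes> y) \<circ> (\<lambda>x. (x, inv a)))"
    using continuous_mult by (rule continuous_map_compose)
  then have "openin T {x \<in> topspace T. ((\<lambda>(x, y). x \<otimes> y) \<circ> (\<lambda>x. (x, inv a))) x \<in> L}"
    using L by (rule openin_continuous_map_preimage)
  moreover have "{x \<in> topspace T. ((\<lambda>(x, y). x \<otimes> y) \<circ> (\<lambda>x. (x, inv a))) x \<in> L} = L #> a"
  proof (intro equalityI subsetI)
    fix x assume "x \<in> {x \<in> topspace T. ((\<lambda>(x, y). x \<otimes> y) \<circ> (\<lambda>x. (x, inv a))) x \<in> L}"
    then have x: "x \<in> carrier G" "x \<otimes> inv a \<in> L" by (auto simp: topspace_eq_carrier)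
    have "x = (x \<otimes> inv a) \<otimes> a" using x a by (simp add: m_assoc)
    then show "x \<in> L #> a" using x(2) unfolding r_coset_def by blast
  next
    fix x assume "x \<in> L #> a"
    then show "x \<in> {x \<in> topspace T. ((\<lambda>(x, y). x \<otimes> y) \<circ> (\<lambda>x. (x, inv a))) x \<in> L}"
      using sub a by (auto simp: r_coset_def topspace_eq_carrier m_assoc subset_iff)
  qed
  ultimately show ?thesis by simp
qed

text \<open>The complement is a union of cosets, which are open.\<close>

lemma open_subgroup_closedin:
  assumes H: "subgroup H G" and op: "openin T H"
  shows "closedin T H"
proof -
  have "carrier G - H = (\<Union>a\<in>carrier G - H. H #> a)"
  proof (intro equalityI subsetI)
    fix x assume "x \<in> carrier G - H"
    then show "x \<in> (\<Union>a\<in>carrier G - H. H #> a)" using rcos_self[OF _ H] by blast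
  next
    fix x assume "x \<in> (\<Union>a\<in>carrier G - H. H #> a)"
    then obtain a h where a: "a \<in> carrier G" "a \<notin> H" and h: "h \<in> H" "x = h \<otimes> a"
      by (auto simp: r_coset_def)
    have hc: "h \<in> carrier G" using subgroup.mem_carrier[OF H h(1)] .
    have "a = inv h \<otimes> x" using a h hc by (simp add: m_assoc[symmetric])
    then have "x \<notin> H"
      using a(2) h(1) subgroup.m_closed[OF H] subgroup.m_inv_closed[OF H] by metis
    then show "x \<in> carrier G - H" using a h hc by simp
  qed
  moreover have "openin T (\<Union>a\<in>carrier G - H. H #> a)"
    using openin_r_coset[OF op] by auto
  ultimately have "openin T (carrier G - H)" by metis
  then show ?thesis
    using openin_subset[OF op] by (simp add: closedin_def topspace_eq_carrier)
qed

text \<open>The cosets of \<open>L\<close> form an open partition, of which only finitely many members meet a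
  compact set.\<close>

lemma finite_rcosets_compact_open:
  assumes K: "compactin T K" and L: "subgroup L G" "openin T L"
  shows "finite (rcosets\<^bsub>G\<lparr>carrier := K\<rparr>\<^esub> L)"
proof -
  let ?C = "(\<lambda>a. L #> a) ` K"
  have Kc: "K \<subseteq> carrier G" using compactin_subset_topspace[OF K] topspace_eq_carrier by simp
  have "\<And>C. C \<in> ?C \<Longrightarrow> openin T C" using openin_r_coset[OF L(2)] Kc by auto
  moreover have "K \<subseteq> \<Union>?C" using rcos_self[OF _ L(1)] Kc by blast
  ultimately obtain F where F: "finite F" "F \<subseteq> ?C" "K \<subseteq> \<Union>F"
    using compactinD[OF K] by metis
  have "?C \<subseteq> F"
  proof
    fix C assume "C \<in> ?C"
    then obtain a where a: "a \<in> K" "C = L #> a" by blast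
    then obtain D where D: "D \<in> F" "a \<in> D" using F(3) by blast
    then obtain b where b: "b \<in> K" "D = L #> b" using F(2) by (meson imageE subsetD)
    have "L #> b = L #> a"
      using D b Kc by (intro repr_independence[OF _ _ L(1)]) auto
    then show "C \<in> F" using a(2) b(2) D(1) by simp
  qed
  then show ?thesis using F(1) unfolding rcosets_carrier_update by (rule finite_subset)
qed

lemma compact_open_subgroups_open_subgroup:
  assumes H: "subgroup H G" "openin T H"
  shows "compact_open_subgroups (G\<lparr>carrier := H\<rparr>) (subtopology T H)
       = {U \<in> compact_open_subgroups G T. U \<subseteq> H}"
proof -
  have "subgroup U (G\<lparr>carrier := H\<rparr>) \<longleftrightarrow> subgroup U G \<and> U \<subseteq> H" for U
    using incl_subgroup[OF H(1)] subgroup_incl[OF _ H(1)] subgroup.subset[of U "G\<lparr>carrier := H\<rparr>"]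
    by auto
  then show ?thesis
    using openin_open_subtopology[OF H(2)]
    by (auto simp: compact_open_subgroups_def compactin_subtopology)
qed

lemma compact_open_subgroups_Int:
  assumes "U \<in> compact_open_subgroups G T" and H: "subgroup H G" "openin T H"
  shows "U \<inter> H \<in> compact_open_subgroups G T"
  using assms closed_Int_compactin[OF open_subgroup_closedin[OF H], of U]
  by (auto simp: compact_open_subgroups_def subgroups_Inter_pair Int_commute)

lemma compact_open_subgroups_image:
  assumes U: "U \<in> compact_open_subgroups G T" and \<phi>: "topological_automorphism G T \<phi>"
  shows "\<phi> ` U \<in> compact_open_subgroups G T"
proof -
  have iso: "\<phi> \<in> iso G G" and hom: "homeomorphic_map T T \<phi>"
    using \<phi> by (auto simp: topological_automorphism_def)
  interpret group_hom G G \<phi>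
    using iso by unfold_locales (auto simp: iso_def)
  have "openin T (\<phi> ` U)"
    using hom U homeomorphic_imp_open_map[OF hom]
    by (auto simp: compact_open_subgroups_def open_map_def)
  moreover have "compactin T (\<phi> ` U)"
    using U homeomorphic_imp_continuous_map[OF hom]
    by (auto simp: compact_open_subgroups_def intro: image_compactin)
  ultimately show ?thesis
    using U subgroup_img_is_subgroup by (auto simp: compact_open_subgroups_def)
qed

text \<open>The scales are minima over two families of indices. The indices for \<open>H\<close> occur among
  those for \<open>G\<close>, and each index for \<open>G\<close> is at least the one obtained by intersecting
  with \<open>H\<close>.\<close>

lemma restricted_scale_open_stable:
  assumes \<phi>: "topological_automorphism G T \<phi>"
    and H: "subgroup H G" "openin T H" and stable: "\<phi> ` H = H"
  shows "restricted_scale G T \<phi> H = scale G T \<phi>"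
proof -
  define idx where "idx U = subgroup_index G (\<phi> ` U) (U \<inter> \<phi> ` U)" for U
  let ?B = "compact_open_subgroups G T"
  have inj: "inj_on \<phi> (carrier G)"
    using \<phi> by (auto simp: topological_automorphism_def iso_def bij_betw_def)
  have idx_Int: "idx (U \<inter> H) \<le> idx U" if U: "U \<in> ?B" for U
  proof -
    have \<phi>U: "\<phi> ` U \<in> ?B" by (rule compact_open_subgroups_image[OF U \<phi>])
    have sub: "subgroup (U \<inter> \<phi> ` U) G" and op: "openin T (U \<inter> \<phi> ` U)"
      using U \<phi>U by (auto simp: compact_open_subgroups_def subgroups_Inter_pair)
    have "finite (rcosets\<^bsub>G\<lparr>carrier := \<phi> ` U\<rparr>\<^esub> (U \<inter> \<phi> ` U))"
      using \<phi>U sub op by (intro finite_rcosets_compact_open) (auto simp: compact_open_subgroups_def)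
    then have "subgroup_index G (\<phi> ` U \<inter> H) ((U \<inter> \<phi> ` U) \<inter> H) \<le> idx U"
      unfolding idx_def by (rule subgroup_index_Int_le[OF H(1) sub])
    moreover have "\<phi> ` (U \<inter> H) = \<phi> ` U \<inter> H"
    proof -
      have "U \<subseteq> carrier G" "H \<subseteq> carrier G"
        using U H by (auto simp: compact_open_subgroups_def dest: subgroup.subset)
      then show ?thesis using inj_on_image_Int[OF inj] stable by metis
    qed
    moreover have "(U \<inter> H) \<inter> (\<phi> ` U \<inter> H) = (U \<inter> \<phi> ` U) \<inter> H" by blast
    ultimately show ?thesis by (simp add: idx_def)
  qed
  have scale_G: "scale G T \<phi> = (LEAST n. \<exists>U\<in>?B. n = idx U)"
    by (simp add: scale_def idx_def)
  have "(restrict \<phi> H) ` U = \<phi> ` U" if "U \<subseteq> H" for U using that by auto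
  then have scale_H: "restricted_scale G T \<phi> H = (LEAST n. \<exists>U\<in>{U \<in> ?B. U \<subseteq> H}. n = idx U)"
    unfolding restricted_scale_def scale_def compact_open_subgroups_open_subgroup[OF H]
    by (intro arg_cong[where f = Least] ext bex_cong) (auto simp: idx_def subgroup_index_def)
  show ?thesis
  proof (cases "?B = {}")
    case True
    \<comment> \<open>Both scales are then the least element of the empty set, the same unspecified value. So
      van Dantzig's theorem can be avoided.\<close>
    then show ?thesis unfolding scale_G scale_H by simp
  next
    case False
    then have "\<exists>n. \<exists>U\<in>?B. n = idx U" by blast
    from LeastI_ex[OF this] obtain U where U: "U \<in> ?B" "scale G T \<phi> = idx U"
      unfolding scale_G by blast
    have UH: "U \<inter> H \<in> {U \<in> ?B. U \<subseteq> H}"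
      using compact_open_subgroups_Int[OF U(1) H] by simp
    then have "\<exists>n. \<exists>U\<in>{U \<in> ?B. U \<subseteq> H}. n = idx U" by blast
    from LeastI_ex[OF this] obtain V where V: "V \<in> ?B" "restricted_scale G T \<phi> H = idx V"
      unfolding scale_H by blast
    have "restricted_scale G T \<phi> H \<le> idx (U \<inter> H)"
      unfolding scale_H by (rule Least_le) (use UH in blast)
    also have "\<dots> \<le> scale G T \<phi>" using idx_Int U by simp
    finally have "restricted_scale G T \<phi> H \<le> scale G T \<phi>" .
    moreover have "scale G T \<phi> \<le> restricted_scale G T \<phi> H"
      unfolding V(2) scale_G by (rule Least_le) (use V(1) in blast)
    ultimately show ?thesis by (rule antisym)
  qed
qed

end

theorem proposition4p8:
  fixes G :: "('a, 'b) monoid_scheme"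
    and T :: "'a topology"
    and \<phi> :: "'a \<Rightarrow> 'a"
    and I :: "'i set"
    and H :: "'i \<Rightarrow> 'a set"
  assumes "tdlc_group G T"
    and "topological_automorphism G T \<phi>"
    and "\<And>i. i \<in> I \<Longrightarrow> subgroup (H i) G"
    and "\<And>i. i \<in> I \<Longrightarrow> openin T (H i)"
    and "\<And>i. i \<in> I \<Longrightarrow> \<phi> ` H i = H i"
    and "directed_family I H"
    and "carrier G = (\<Union>i\<in>I. H i)"
  shows "\<exists>j\<in>I. scale G T \<phi> = restricted_scale G T \<phi> (H j) \<and>
           (\<forall>i\<in>I. restricted_scale G T \<phi> (H i) \<le> restricted_scale G T \<phi> (H j))"
proof -
  interpret tdlc_group G T by fact
  have "restricted_scale G T \<phi> (H i) = scale G T \<phi>" if "i \<in> I" for i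
    using that assms by (intro restricted_scale_open_stable) auto
  moreover obtain j where "j \<in> I"
    using assms(6) by (auto simp: directed_family_def)
  ultimately show ?thesis by auto
qed

end
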